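(* Let $\hat g=D_n^{(1)}$ and let $Z^{(l)}$ be the $2n\times2n$ matrix $$Z^{(l)}=\begin{pmatrix}\mathbb I_{(n-1)\times(n-1)}&&&\\&0&1&\\&1&0&\\&&&\mathbb I_{(n-1)\times(n-1)}\end{pmatrix}.$$ Then the R-matrix of type $D_n^{(1)}$ obeys $$Z^{(l)}_1R_{12}(u)Z^{(l)}_1=Z^{(l)}_2R_{12}(u)Z^{(l)}_2.$$ Furthermore, for $0\le p<n$ the K-matrices obey $$Z^{(l)}K^R(u,p)Z^{(l)}=K^R(u,p),\qquad Z^{(l)}K^L(u,p)Z^{(l)}=K^L(u,p).$$
   Context: **R-matrix of type $D_n^{(1)}$.** Fix $n\ge1$, $\eta\in\mathbb C$, $d=2n$, $\mathcal V=\mathbb C^{2n}$, $e_{ij}$ the elementary $2n\times2n$ matrices. Let $\kappa=2n-2$, $\alpha'=2n+1-\alpha$, $\bar\alpha=\alpha+\frac12$ if $\alpha\le n$ and $\bar\alpha=\alpha-\frac12$ if $\alpha\ge n+1$. Let $$c(u)=2\sinh(\tfrac u2-2\eta)\sinh(\tfrac u2-\kappa\eta),\ b(u)=2\sinh(\tfrac u2)\sinh(\tfrac u2-\kappa\eta),\ e(u)=-2e^{-u/2}\sinh(2\eta)\sinh(\tfrac u2-\kappa\eta),\ \bar e(u)=e^ue(u),$$ $a_{\alpha\alpha}(u)=2\sinh(\frac u2)\sinh(\frac u2-(\kappa-2)\eta)$, and, with upper signs for $\alpha<\beta$ and lower signs for $\alpha>\beta$, $a_{\alpha\beta}(u)=2\sinh(2\eta)e^{\mp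 u/2}[e^{(\pm\kappa+2(\bar\alpha-\bar\beta))\eta}\sinh(\frac u2)-\delta_{\alpha\beta'}\sinh(\frac u2-\kappa\eta)]$. Then, on $\mathcal V\otimes\mathcal V$, $$R_{12}(u)=R(u)=c(u)\sum_{\alpha}e_{\alpha\alpha}\otimes e_{\alpha\alpha}+b(u)\sum_{\alpha\neq\beta,\beta'}e_{\alpha\alpha}\otimes e_{\beta\beta}+\Big(e(u)\sum_{\alpha<\beta,\alpha\ne\beta'}+\bar e(u)\sum_{\alpha>\beta,\alpha\ne\beta'}\Big)e_{\alpha\beta}\otimes e_{\beta\alpha}+\sum_{\alpha,\beta}a_{\alpha\beta}(u)e_{\alpha\beta}\otimes e_{\alpha'\beta'}.$$ For a $2n\times2n$ matrix $X$, $X_1=X\otimes\mathbb I$, $X_2=\mathbb I\otimes X$. **K-matrices.** $\rho=-2\kappa\eta$; fix $\gamma_0\in\{1,-1\}$; $\gamma=\gamma_0e^{(4p-2)\eta+\rho/2}$. $K^R(u,p)$ is diagonal with first $p$ entries $e^{-u}$, middle $2n-2p$ entries $\frac{\gamma e^u+1}{\gamma+e^u}$, last $p$ entries $e^u$. $M=\sum_\alpha e^{4(\frac{2n+1}2-\bar\alpha)\eta}e_{\alpha\alpha}$; $K^L(u,p)=K^R(-u-\rho,p)M$. Identities in $u$ are understood as identities of meromorphic functions. *)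

theory Defs
  imports Complex_Main "Jordan_Normal_Form.Matrix"
begin

text \<open>
  Labels such as \<open>\<alpha>\<close>, \<open>\<beta>\<close> range over \<open>{1..2*n}\<close>, whereas matrix entries are addressed
  from 0; label \<open>\<alpha>\<close> corresponds to row and column \<open>\<alpha> - 1\<close>.
\<close>

definition elem_mat :: "nat \<Rightarrow> nat \<Rightarrow> nat \<Rightarrow> complex mat" where
  "elem_mat d i j = mat d d (\<lambda>(k, l). if Suc k = i \<and> Suc l = j then 1 else 0)"

definition kron :: "complex mat \<Rightarrow> complex mat \<Rightarrow> complex mat" (infixl "\<otimes>\<^sub>K" 75) where
  "A \<otimes>\<^sub>K B = mat (dim_row A * dim_row B) (dim_col A * dim_col B)
     (\<lambda>(i, j). A $$ (i div dim_row B, j div dim_col B) * B $$ (i mod dim_row B, j mod dim_col B))"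

definition mat_sum :: "nat \<Rightarrow> ('i \<Rightarrow> complex mat) \<Rightarrow> 'i set \<Rightarrow> complex mat" where
  "mat_sum N f I = finsum (module_mat TYPE(complex) N N) f I"

lemma index_mat_sum:
  assumes "finite I" "\<And>x. x \<in> I \<Longrightarrow> f x \<in> carrier_mat N N"
  shows "mat_sum N f I \<in> carrier_mat N N"
    and "i < N \<Longrightarrow> j < N \<Longrightarrow> mat_sum N f I $$ (i, j) = (\<Sum>x\<in>I. f x $$ (i, j))"
proof -
  interpret M: abelian_group "module_mat TYPE(complex) N N"
    by (rule abelian_group_mat)
  have "mat_sum N f I \<in> carrier_mat N N \<and>
      (i < N \<longrightarrow> j < N \<longrightarrow> mat_sum N f I $$ (i, j) = (\<Sum>x\<in>I. f x $$ (i, j)))"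
    using assms
  proof (induction I rule: finite_induct)
    case empty
    show ?case
      unfolding mat_sum_def by (simp add: module_mat_simps)
  next
    case (insert x I)
    have f: "f \<in> I \<rightarrow> carrier (module_mat TYPE(complex) N N)"
      "f x \<in> carrier (module_mat TYPE(complex) N N)"
      using insert.prems by (auto simp: module_mat_simps)
    have "mat_sum N f (insert x I) = f x + mat_sum N f I"
      unfolding mat_sum_def using M.finsum_insert[OF insert.hyps f]
      by (simp add: module_mat_simps)
    then show ?case
      using insert by auto
  qed
  then show "mat_sum N f I \<in> carrier_mat N N"
    and "i < N \<Longrightarrow> j < N \<Longrightarrow> mat_sum N f I $$ (i, j) = (\<Sum>x\<in>I. f x $$ (i, j))"
    by auto
qed

definition leg1 :: "nat \<Rightarrow> complex mat \<Rightarrow> complex mat" where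
  "leg1 n X = X \<otimes>\<^sub>K 1\<^sub>m (2 * n)"

definition leg2 :: "nat \<Rightarrow> complex mat \<Rightarrow> complex mat" where
  "leg2 n X = 1\<^sub>m (2 * n) \<otimes>\<^sub>K X"

definition kap :: "nat \<Rightarrow> complex" where
  "kap n = 2 * of_nat n - 2"

definition conj_ix :: "nat \<Rightarrow> nat \<Rightarrow> nat" where
  "conj_ix n \<alpha> = 2 * n + 1 - \<alpha>"

definition bar_ix :: "nat \<Rightarrow> nat \<Rightarrow> complex" where
  "bar_ix n \<alpha> = (if \<alpha> \<le> n then of_nat \<alpha> + 1/2 else of_nat \<alpha> - 1/2)"

definition c_fun :: "nat \<Rightarrow> complex \<Rightarrow> complex \<Rightarrow> complex" where
  "c_fun n \<eta> u = 2 * sinh (u/2 - 2 * \<eta>) * sinh (u/2 - kap n * \<eta>)"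

definition b_fun :: "nat \<Rightarrow> complex \<Rightarrow> complex \<Rightarrow> complex" where
  "b_fun n \<eta> u = 2 * sinh (u/2) * sinh (u/2 - kap n * \<eta>)"

definition e_fun :: "nat \<Rightarrow> complex \<Rightarrow> complex \<Rightarrow> complex" where
  "e_fun n \<eta> u = - 2 * exp (- u/2) * sinh (2 * \<eta>) * sinh (u/2 - kap n * \<eta>)"

definition ebar_fun :: "nat \<Rightarrow> complex \<Rightarrow> complex \<Rightarrow> complex" where
  "ebar_fun n \<eta> u = exp u * e_fun n \<eta> u"

definition a_fun :: "nat \<Rightarrow> complex \<Rightarrow> nat \<Rightarrow> nat \<Rightarrow> complex \<Rightarrow> complex" where
  "a_fun n \<eta> \<alpha> \<beta> u =
     (if \<alpha> = \<beta> then 2 * sinh (u/2) * sinh (u/2 - (kap n - 2) * \<eta>)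
      else let s = (if \<alpha> < \<beta> then 1 else - 1) in
        2 * sinh (2 * \<eta>) * exp (- s * u/2) *
          (exp ((s * kap n + 2 * (bar_ix n \<alpha> - bar_ix n \<beta>)) * \<eta>) * sinh (u/2)
           - (if \<alpha> = conj_ix n \<beta> then 1 else 0) * sinh (u/2 - kap n * \<eta>)))"

definition R_mat :: "nat \<Rightarrow> complex \<Rightarrow> complex \<Rightarrow> complex mat" where
  "R_mat n \<eta> u =
     (let D = {1..2 * n}; E = elem_mat (2 * n); N = 2 * n * (2 * n) in
        c_fun n \<eta> u \<cdot>\<^sub>m mat_sum N (\<lambda>\<alpha>. E \<alpha> \<alpha> \<otimes>\<^sub>K E \<alpha> \<alpha>) D
      + b_fun n \<eta> u \<cdot>\<^sub>m mat_sum N (\<lambda>(\<alpha>, \<beta>). E \<alpha> \<alpha> \<otimes>\<^sub>K E \<beta> \<beta>)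
          {(\<alpha>, \<beta>) \<in> D \<times> D. \<alpha> \<noteq> \<beta> \<and> \<alpha> \<noteq> conj_ix n \<beta>}
      + (e_fun n \<eta> u \<cdot>\<^sub>m mat_sum N (\<lambda>(\<alpha>, \<beta>). E \<alpha> \<beta> \<otimes>\<^sub>K E \<beta> \<alpha>)
            {(\<alpha>, \<beta>) \<in> D \<times> D. \<alpha> < \<beta> \<and> \<alpha> \<noteq> conj_ix n \<beta>}
         + ebar_fun n \<eta> u \<cdot>\<^sub>m mat_sum N (\<lambda>(\<alpha>, \<beta>). E \<alpha> \<beta> \<otimes>\<^sub>K E \<beta> \<alpha>)
            {(\<alpha>, \<beta>) \<in> D \<times> D. \<alpha> > \<beta> \<and> \<alpha> \<noteq> conj_ix n \<beta>})
      + mat_sum N (\<lambda>(\<alpha>, \<beta>). a_fun n \<eta> \<alpha> \<beta> u \<cdot>\<^sub>m (E \<alpha> \<beta> \<otimes>\<^sub>K E (conj_ix n \<alpha>) (conj_ix n \<beta>)))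
          (D \<times> D))"

definition rho :: "nat \<Rightarrow> complex \<Rightarrow> complex" where
  "rho n \<eta> = - 2 * kap n * \<eta>"

definition gam :: "nat \<Rightarrow> complex \<Rightarrow> complex \<Rightarrow> nat \<Rightarrow> complex" where
  "gam n \<eta> \<gamma>\<^sub>0 p = \<gamma>\<^sub>0 * exp ((4 * of_nat p - 2) * \<eta> + rho n \<eta> / 2)"

text \<open>
  The middle entries have possible poles where \<open>gam n \<eta> \<gamma>\<^sub>0 p + exp u = 0\<close>; there the value below
  is an artefact of total division.
\<close>

definition KR :: "nat \<Rightarrow> complex \<Rightarrow> complex \<Rightarrow> nat \<Rightarrow> complex \<Rightarrow> complex mat" where
  "KR n \<eta> \<gamma>\<^sub>0 p u = mat_diag (2 * n) (\<lambda>i.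
     if i < p then exp (- u)
     else if i < 2 * n - p then (gam n \<eta> \<gamma>\<^sub>0 p * exp u + 1) / (gam n \<eta> \<gamma>\<^sub>0 p + exp u)
     else exp u)"

definition M_mat :: "nat \<Rightarrow> complex \<Rightarrow> complex mat" where
  "M_mat n \<eta> = mat_diag (2 * n)
     (\<lambda>i. exp (4 * ((2 * of_nat n + 1) / 2 - bar_ix n (Suc i)) * \<eta>))"

definition KL :: "nat \<Rightarrow> complex \<Rightarrow> complex \<Rightarrow> nat \<Rightarrow> complex \<Rightarrow> complex mat" where
  "KL n \<eta> \<gamma>\<^sub>0 p u = KR n \<eta> \<gamma>\<^sub>0 p (- u - rho n \<eta>) * M_mat n \<eta>"

definition Zl :: "nat \<Rightarrow> complex mat" where
  "Zl n = diag_block_mat [1\<^sub>m (n - 1), mat_of_rows_list 2 [[0, 1], [1, 0]], 1\<^sub>m (n - 1)]"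

end

theory Submission
  imports Defs "HOL-Combinatorics.Transposition"
begin

text \<open>
  \<open>Z\<close> is the permutation matrix of the transposition \<open>\<sigma> = (n n+1)\<close>. Since \<open>\<sigma>\<close> is an involution,
  the identity for \<open>R\<close> says that the entries of \<open>R\<close> do not change when \<open>\<sigma>\<close> is applied
  to all four indices. The transposition commutes with \<open>\<alpha> \<mapsto> \<alpha>'\<close>, preserves \<open>bar \<alpha>\<close>, and preserves
  the order of every pair except \<open>{n, n + 1}\<close>; on that pair only the coefficients \<open>a\<close> matter, and
  \<open>a\<^sub>n\<^sub>,\<^sub>n\<^sub>+\<^sub>1 = a\<^sub>n\<^sub>+\<^sub>1\<^sub>,\<^sub>n\<close>. The K-matrices are diagonal with equal entries
  at \<open>n\<close> and \<open>n + 1\<close>.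
\<close>

section \<open>Permutation matrices of involutions\<close>

definition perm_mat :: "nat \<Rightarrow> (nat \<Rightarrow> nat) \<Rightarrow> complex mat" where
  "perm_mat N \<pi> = mat N N (\<lambda>(i, j). if j = \<pi> i then 1 else 0)"

text \<open>The left factor replaces row i by row \<pi> i; on the right, column j has its only 1 in
  row \<pi> j because \<pi> is its own inverse.\<close>

lemma perm_mat_conj_index:
  assumes A: "A \<in> carrier_mat N N"
    and \<pi>: "\<And>i. i < N \<Longrightarrow> \<pi> i < N" "\<And>i. i < N \<Longrightarrow> \<pi> (\<pi> i) = i"
    and ij: "i < N" "j < N"
  shows "(perm_mat N \<pi> * A * perm_mat N \<pi>) $$ (i, j) = A $$ (\<pi> i, \<pi> j)"
proof -
  have left: "(perm_mat N \<pi> * A) $$ (i, l) = A $$ (\<pi> i, l)" if "l < N" for l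
  proof -
    have "(perm_mat N \<pi> * A) $$ (i, l) = (\<Sum>k\<in>{0..<N}. perm_mat N \<pi> $$ (i, k) * A $$ (k, l))"
      using A ij that by (simp add: perm_mat_def scalar_prod_def)
    also have "\<dots> = (\<Sum>k\<in>{0..<N}. if k = \<pi> i then A $$ (k, l) else 0)"
      using ij by (intro sum.cong) (auto simp: perm_mat_def)
    finally have "(perm_mat N \<pi> * A) $$ (i, l) = (\<Sum>k\<in>{0..<N}. if k = \<pi> i then A $$ (k, l) else 0)" .
    then show ?thesis using \<pi> ij by simp
  qed
  have right: "perm_mat N \<pi> $$ (k, j) = (if k = \<pi> j then 1 else 0)" if "k < N" for k
    using \<pi> ij that by (auto simp: perm_mat_def)
  have "(perm_mat N \<pi> * A * perm_mat N \<pi>) $$ (i, j)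
      = (\<Sum>k\<in>{0..<N}. (perm_mat N \<pi> * A) $$ (i, k) * perm_mat N \<pi> $$ (k, j))"
    using A ij by (simp add: scalar_prod_def perm_mat_def)
  also have "\<dots> = (\<Sum>k\<in>{0..<N}. if k = \<pi> j then A $$ (\<pi> i, k) else 0)"
    using \<pi> ij by (intro sum.cong) (auto simp: left right)
  finally show ?thesis using \<pi> ij by simp
qed

lemma perm_mat_conj_mat_diag:
  assumes \<pi>: "\<And>i. i < N \<Longrightarrow> \<pi> i < N" "\<And>i. i < N \<Longrightarrow> \<pi> (\<pi> i) = i"
    and f: "\<And>i. i < N \<Longrightarrow> f (\<pi> i) = f i"
  shows "perm_mat N \<pi> * mat_diag N f * perm_mat N \<pi> = mat_diag N f"
proof (rule eq_matI)
  fix i j assume "i < dim_row (mat_diag N f)" "j < dim_col (mat_diag N f)"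
  then have ij: "i < N" "j < N" by (auto simp: mat_diag_def)
  have "\<pi> i = \<pi> j \<longleftrightarrow> i = j" using \<pi> ij by metis
  then show "(perm_mat N \<pi> * mat_diag N f * perm_mat N \<pi>) $$ (i, j) = mat_diag N f $$ (i, j)"
    using perm_mat_conj_index[OF _ \<pi> ij, of "mat_diag N f"] \<pi> ij f
    by (simp add: mat_diag_def)
qed (auto simp: mat_diag_def perm_mat_def)

section \<open>Conjugation on one leg of the tensor square\<close>

lemma div_mod_less:
  fixes i d :: nat
  assumes "i < d * d"
  shows "i div d < d" "i mod d < d"
  using assms by (auto simp: less_mult_imp_div_less intro!: mod_less_divisor Nat.gr0I)

lemma eq_mult_add_iff:
  fixes j a b d :: nat
  assumes "b < d"
  shows "j = a * d + b \<longleftrightarrow> j div d = a \<and> j mod d = b"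
  using assms div_mult_mod_eq[of j d] by auto

text \<open>A row of the Kronecker product encodes the pair \<open>(i div d, i mod d)\<close>, so
  \<pi> on the first leg acts on the quotient alone.\<close>

lemma kron_perm_mat_one:
  "perm_mat d \<pi> \<otimes>\<^sub>K 1\<^sub>m d = perm_mat (d * d) (\<lambda>i. \<pi> (i div d) * d + i mod d)"
  if \<pi>: "\<And>i. i < d \<Longrightarrow> \<pi> i < d"
proof (rule eq_matI)
  fix i j assume "i < dim_row (perm_mat (d * d) (\<lambda>i. \<pi> (i div d) * d + i mod d))"
    "j < dim_col (perm_mat (d * d) (\<lambda>i. \<pi> (i div d) * d + i mod d))"
  then have ij: "i < d * d" "j < d * d" by (auto simp: perm_mat_def)
  have "j = \<pi> (i div d) * d + i mod d \<longleftrightarrow> j div d = \<pi> (i div d) \<and> j mod d = i mod d"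
    using div_mod_less[OF ij(1)] by (intro eq_mult_add_iff)
  then show "(perm_mat d \<pi> \<otimes>\<^sub>K 1\<^sub>m d) $$ (i, j)
      = perm_mat (d * d) (\<lambda>i. \<pi> (i div d) * d + i mod d) $$ (i, j)"
    using ij div_mod_less[OF ij(1)] div_mod_less[OF ij(2)] by (auto simp: kron_def perm_mat_def)
qed (auto simp: kron_def perm_mat_def)

lemma kron_one_perm_mat:
  "1\<^sub>m d \<otimes>\<^sub>K perm_mat d \<pi> = perm_mat (d * d) (\<lambda>i. i div d * d + \<pi> (i mod d))"
  if \<pi>: "\<And>i. i < d \<Longrightarrow> \<pi> i < d"
proof (rule eq_matI)
  fix i j assume "i < dim_row (perm_mat (d * d) (\<lambda>i. i div d * d + \<pi> (i mod d)))"
    "j < dim_col (perm_mat (d * d) (\<lambda>i. i div d * d + \<pi> (i mod d)))"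
  then have ij: "i < d * d" "j < d * d" by (auto simp: perm_mat_def)
  have "j = i div d * d + \<pi> (i mod d) \<longleftrightarrow> j div d = i div d \<and> j mod d = \<pi> (i mod d)"
    using div_mod_less[OF ij(1)] \<pi> by (intro eq_mult_add_iff) auto
  then show "(1\<^sub>m d \<otimes>\<^sub>K perm_mat d \<pi>) $$ (i, j)
      = perm_mat (d * d) (\<lambda>i. i div d * d + \<pi> (i mod d)) $$ (i, j)"
    using ij div_mod_less[OF ij(1)] div_mod_less[OF ij(2)] by (auto simp: kron_def perm_mat_def)
qed (auto simp: kron_def perm_mat_def)

lemma mult_add_less_square:
  fixes a b d :: nat
  assumes "a < d" "b < d"
  shows "a * d + b < d * d"
proof -
  have "a * d + b < Suc a * d" using assms by simp
  also have "\<dots> \<le> d * d" using assms by (intro mult_right_mono) auto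
  finally show ?thesis .
qed

text \<open>Conjugation on the first leg permutes the first row and column indices, on the second
  leg the second ones; as \<pi> is an involution, both agree once \<pi> on all four indices changes
  nothing.\<close>

lemma kron_perm_mat_conj_eq:
  assumes A: "A \<in> carrier_mat (d * d) (d * d)"
    and \<pi>: "\<And>i. i < d \<Longrightarrow> \<pi> i < d" "\<And>i. i < d \<Longrightarrow> \<pi> (\<pi> i) = i"
    and inv: "\<And>i k j l. i < d \<Longrightarrow> k < d \<Longrightarrow> j < d \<Longrightarrow> l < d \<Longrightarrow>
      A $$ (\<pi> i * d + \<pi> k, \<pi> j * d + \<pi> l) = A $$ (i * d + k, j * d + l)"
  shows "(perm_mat d \<pi> \<otimes>\<^sub>K 1\<^sub>m d) * A * (perm_mat d \<pi> \<otimes>\<^sub>K 1\<^sub>m d)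
    = (1\<^sub>m d \<otimes>\<^sub>K perm_mat d \<pi>) * A * (1\<^sub>m d \<otimes>\<^sub>K perm_mat d \<pi>)"
proof -
  let ?p = "\<lambda>i. \<pi> (i div d) * d + i mod d"
  let ?q = "\<lambda>i. i div d * d + \<pi> (i mod d)"
  have p: "?p i < d * d" "?p (?p i) = i" "?q i < d * d" "?q (?q i) = i" if "i < d * d" for i
    using div_mod_less[OF that] \<pi> by (auto simp: mult_add_less_square)
  have kron: "perm_mat d \<pi> \<otimes>\<^sub>K 1\<^sub>m d = perm_mat (d * d) ?p"
    "1\<^sub>m d \<otimes>\<^sub>K perm_mat d \<pi> = perm_mat (d * d) ?q"
    using \<pi>(1) by (intro kron_perm_mat_one kron_one_perm_mat; blast)+
  show ?thesis
    unfolding kron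
  proof (rule eq_matI)
    fix i j
    assume "i < dim_row (perm_mat (d * d) ?q * A * perm_mat (d * d) ?q)"
      "j < dim_col (perm_mat (d * d) ?q * A * perm_mat (d * d) ?q)"
    then have ij: "i < d * d" "j < d * d" by (auto simp: perm_mat_def)
    note dm = div_mod_less[OF ij(1)] div_mod_less[OF ij(2)]
    \<comment> \<open>With \<pi> already applied to the first components, \<open>inv\<close> cancels
      it there and moves it to the second ones.\<close>
    have "A $$ (?p i, ?p j) = A $$ (?q i, ?q j)"
      using inv[of "\<pi> (i div d)" "i mod d" "\<pi> (j div d)" "j mod d"] dm \<pi> by simp
    then show "(perm_mat (d * d) ?p * A * perm_mat (d * d) ?p) $$ (i, j)
        = (perm_mat (d * d) ?q * A * perm_mat (d * d) ?q) $$ (i, j)"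
      using perm_mat_conj_index[OF A p(1,2) ij] perm_mat_conj_index[OF A p(3,4) ij] by simp
  qed (auto simp: perm_mat_def)
qed

lemma Zl_eq_perm_mat:
  assumes "n \<ge> 1"
  shows "Zl n = perm_mat (2 * n) (transpose (n - 1) n)"
proof -
  obtain m where m: "n = Suc m" using assms by (cases n) auto
  let ?B = "mat_of_rows_list 2 [[0, 1], [1, 0]] :: complex mat"
  have B: "?B $$ (a, b) = (if a = b then 0 else 1)" if "a < 2" "b < 2" for a b
    using that by (auto simp: mat_of_rows_list_def less_2_cases_iff)
  have dimB [simp]: "dim_row ?B = 2" "dim_col ?B = 2"
    by (auto simp: mat_of_rows_list_def)
  show ?thesis
  proof (rule eq_matI)
    fix i j
    assume "i < dim_row (perm_mat (2 * n) (transpose (n - 1) n))"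
      "j < dim_col (perm_mat (2 * n) (transpose (n - 1) n))"
    then have ij: "i < 2 * m + 2" "j < 2 * m + 2" by (auto simp: perm_mat_def m)
    \<comment> \<open>Upper identity block, the two rows of the swap block, lower identity
      block.\<close>
    consider "i < m" | "i = m" | "i = Suc m" | "i > Suc m" by linarith
    then show "Zl n $$ (i, j) = perm_mat (2 * n) (transpose (n - 1) n) $$ (i, j)"
      using ij
      by cases (simp_all add: m Zl_def perm_mat_def Let_def B transpose_def; linarith)+
  qed (auto simp: m Zl_def perm_mat_def Let_def)
qed

section \<open>Entries of the R-matrix\<close>

lemma kron_elem_mat_carrier [simp]:
  "elem_mat d a b \<otimes>\<^sub>K elem_mat d a' b' \<in> carrier_mat (d * d) (d * d)"
  by (simp add: kron_def elem_mat_def)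

lemma kron_elem_mat_index:
  assumes "i < d" "k < d" "j < d" "l < d"
  shows "(elem_mat d a b \<otimes>\<^sub>K elem_mat d a' b') $$ (i * d + k, j * d + l) =
    (if a = Suc i \<and> b = Suc j \<and> a' = Suc k \<and> b' = Suc l then 1 else 0)"
  using assms by (auto simp: kron_def elem_mat_def mult_add_less_square)

text \<open>Arguments are labels, counted from 1: i, k are the row labels on the two legs and j, l
  the column labels.\<close>

definition R_entry :: "nat \<Rightarrow> complex \<Rightarrow> complex \<Rightarrow> nat \<Rightarrow> nat \<Rightarrow> nat \<Rightarrow> nat \<Rightarrow> complex" where
  "R_entry n \<eta> u i k j l =
     c_fun n \<eta> u * (if i = j \<and> k = i \<and> l = i then 1 else 0)
   + b_fun n \<eta> u * (if i = j \<and> k = l \<and> i \<noteq> k \<and> i \<noteq> conj_ix n k then 1 else 0)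
   + (e_fun n \<eta> u * (if k = j \<and> l = i \<and> i < j \<and> i \<noteq> conj_ix n j then 1 else 0)
      + ebar_fun n \<eta> u * (if k = j \<and> l = i \<and> i > j \<and> i \<noteq> conj_ix n j then 1 else 0))
   + (if k = conj_ix n i \<and> l = conj_ix n j then a_fun n \<eta> i j u else 0)"

text \<open>A given entry of each sum in \<open>R_mat\<close> receives at most one nonzero term. The
  side conditions on the index set may exclude that term, whence the case distinction.\<close>

lemma mat_sum_index_single:
  assumes S: "finite S" "\<And>y. y \<in> S \<Longrightarrow> f y \<in> carrier_mat N N"
    and ij: "i < N" "j < N"
    and zero: "\<And>y. y \<in> S \<Longrightarrow> y \<noteq> x \<Longrightarrow> f y $$ (i, j) = 0"
  shows "mat_sum N f S $$ (i, j) = (if x \<in> S then f x $$ (i, j) else 0)"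
proof -
  have "mat_sum N f S $$ (i, j) = (\<Sum>y\<in>S. f y $$ (i, j))"
    using S ij by (rule index_mat_sum(2))
  also have "\<dots> = (\<Sum>y\<in>S. if y = x then f x $$ (i, j) else 0)"
    using zero by (intro sum.cong) auto
  finally show ?thesis using S(1) by simp
qed

lemma
  shows R_mat_carrier: "R_mat n \<eta> u \<in> carrier_mat (2 * n * (2 * n)) (2 * n * (2 * n))"
    and R_mat_index: "i < 2 * n \<Longrightarrow> k < 2 * n \<Longrightarrow> j < 2 * n \<Longrightarrow> l < 2 * n \<Longrightarrow>
      R_mat n \<eta> u $$ (i * (2 * n) + k, j * (2 * n) + l)
        = R_entry n \<eta> u (Suc i) (Suc k) (Suc j) (Suc l)"
proof -
  define d where "d = 2 * n"
  define D where "D = {1..d}"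
  let ?E = "elem_mat d" and ?N = "d * d"
  define S1 where "S1 = mat_sum ?N (\<lambda>\<alpha>. ?E \<alpha> \<alpha> \<otimes>\<^sub>K ?E \<alpha> \<alpha>) D"
  define S2 where "S2 = mat_sum ?N (\<lambda>(\<alpha>, \<beta>). ?E \<alpha> \<alpha> \<otimes>\<^sub>K ?E \<beta> \<beta>)
    {(\<alpha>, \<beta>) \<in> D \<times> D. \<alpha> \<noteq> \<beta> \<and> \<alpha> \<noteq> conj_ix n \<beta>}"
  define S3 where "S3 = (\<lambda>P. mat_sum ?N (\<lambda>(\<alpha>, \<beta>). ?E \<alpha> \<beta> \<otimes>\<^sub>K ?E \<beta> \<alpha>)
    {(\<alpha>, \<beta>) \<in> D \<times> D. P \<alpha> \<beta> \<and> \<alpha> \<noteq> conj_ix n \<beta>})"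
  define S4 where "S4 = mat_sum ?N
    (\<lambda>(\<alpha>, \<beta>). a_fun n \<eta> \<alpha> \<beta> u \<cdot>\<^sub>m (?E \<alpha> \<beta> \<otimes>\<^sub>K ?E (conj_ix n \<alpha>) (conj_ix n \<beta>))) (D \<times> D)"
  note S_defs = S1_def S2_def S3_def S4_def
  have R: "R_mat n \<eta> u = c_fun n \<eta> u \<cdot>\<^sub>m S1 + b_fun n \<eta> u \<cdot>\<^sub>m S2
      + (e_fun n \<eta> u \<cdot>\<^sub>m S3 (<) + ebar_fun n \<eta> u \<cdot>\<^sub>m S3 (>)) + S4"
    by (simp only: R_mat_def Let_def S_defs d_def D_def)
  have finD: "finite D" by (simp add: D_def)
  have fin: "finite {(\<alpha>, \<beta>). \<alpha> \<in> D \<and> \<beta> \<in> D \<and> P \<alpha> \<beta>}" for P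
    by (rule finite_subset[of _ "D \<times> D"]) (auto simp: finD)
  have car: "S1 \<in> carrier_mat ?N ?N" "S2 \<in> carrier_mat ?N ?N" "S3 Q \<in> carrier_mat ?N ?N"
    "S4 \<in> carrier_mat ?N ?N" for Q
    unfolding S_defs by (rule index_mat_sum; auto simp: finD fin)+
  show "R_mat n \<eta> u \<in> carrier_mat (2 * n * (2 * n)) (2 * n * (2 * n))"
    unfolding R d_def[symmetric] by (intro add_carrier_mat smult_carrier_mat car)
  assume ix: "i < 2 * n" "k < 2 * n" "j < 2 * n" "l < 2 * n"
  then have ixd: "i < d" "k < d" "j < d" "l < d" by (auto simp: d_def)
  then have ixD: "Suc i \<in> D" "Suc k \<in> D" "Suc j \<in> D" "Suc l \<in> D" by (auto simp: D_def)
  let ?I = "i * d + k" and ?J = "j * d + l"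
  have IJ: "?I < ?N" "?J < ?N" using ixd by (auto intro: mult_add_less_square)
  have Ea: "(x \<cdot>\<^sub>m (?E a b \<otimes>\<^sub>K ?E a' b')) $$ (?I, ?J) = x * (?E a b \<otimes>\<^sub>K ?E a' b') $$ (?I, ?J)"
    for x a b a' b'
    using IJ by (simp add: kron_def elem_mat_def)
  \<comment> \<open>The position fixes the only candidate summand, and its membership in the index
    set becomes the condition in \<open>R_entry\<close>.\<close>
  note ent = mat_sum_index_single[OF _ _ IJ]
  have 1: "S1 $$ (?I, ?J) = (if Suc i = Suc j \<and> Suc k = Suc i \<and> Suc l = Suc i then 1 else 0)"
    unfolding S1_def
    by (subst ent[where x = "Suc i"]) (auto simp: finD kron_elem_mat_index ixd ixD split: if_splits)
  have 2: "S2 $$ (?I, ?J) = (if Suc i = Suc j \<and> Suc k = Suc l \<and> Suc i \<noteq> Suc k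
      \<and> Suc i \<noteq> conj_ix n (Suc k) then 1 else 0)"
    unfolding S2_def
    by (subst ent[where x = "(Suc i, Suc k)"]) (auto simp: fin kron_elem_mat_index ixd ixD split: if_splits)
  have 3: "S3 Q $$ (?I, ?J) = (if Suc k = Suc j \<and> Suc l = Suc i \<and> Q (Suc i) (Suc j)
      \<and> Suc i \<noteq> conj_ix n (Suc j) then 1 else 0)" for Q
    unfolding S3_def
    by (subst ent[where x = "(Suc i, Suc j)"]) (auto simp: fin kron_elem_mat_index ixd ixD split: if_splits)
  have 4: "S4 $$ (?I, ?J) = (if Suc k = conj_ix n (Suc i) \<and> Suc l = conj_ix n (Suc j)
      then a_fun n \<eta> (Suc i) (Suc j) u else 0)"
    unfolding S4_def
    by (subst ent[where x = "(Suc i, Suc j)"]) (auto simp: finD Ea kron_elem_mat_index ixd ixD split: if_splits)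
  have dims: "dim_row S1 = ?N" "dim_col S1 = ?N" "dim_row S2 = ?N" "dim_col S2 = ?N"
    "dim_row (S3 Q) = ?N" "dim_col (S3 Q) = ?N" "dim_row S4 = ?N" "dim_col S4 = ?N" for Q
    using car by auto
  have "R_mat n \<eta> u $$ (?I, ?J) = c_fun n \<eta> u * S1 $$ (?I, ?J) + b_fun n \<eta> u * S2 $$ (?I, ?J)
      + (e_fun n \<eta> u * S3 (<) $$ (?I, ?J) + ebar_fun n \<eta> u * S3 (>) $$ (?I, ?J)) + S4 $$ (?I, ?J)"
    unfolding R using IJ by (simp add: dims)
  then show "R_mat n \<eta> u $$ (i * (2 * n) + k, j * (2 * n) + l)
      = R_entry n \<eta> u (Suc i) (Suc k) (Suc j) (Suc l)"
    unfolding d_def[symmetric] 1 2 3 4 R_entry_def by simp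
qed

section \<open>Invariance under the transposition\<close>

text \<open>On n and n + 1 conjugation is itself the swap, and all other labels are fixed by the
  transposition.\<close>

lemma conj_ix_transpose:
  assumes "1 \<le> i" "i \<le> 2 * n"
  shows "conj_ix n (transpose n (Suc n) i) = transpose n (Suc n) (conj_ix n i)"
  using assms by (auto simp: conj_ix_def transpose_def)

text \<open>\<open>bar_ix\<close> takes the value n + 1/2 at both n and n + 1.\<close>

lemma bar_ix_transpose: "bar_ix n (transpose n (Suc n) i) = bar_ix n i"
  by (auto simp: bar_ix_def transpose_def)

text \<open>As n and n + 1 are adjacent, only their mutual comparison could be reversed, and the
  hypothesis excludes that conjugate pair.\<close>

lemma transpose_less_iff:
  assumes "i \<noteq> conj_ix n j"
  shows "transpose n (Suc n) i < transpose n (Suc n) j \<longleftrightarrow> i < j"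
  using assms by (auto simp: conj_ix_def transpose_def)

text \<open>By the addition formula the left side is (sinh v + cosh v) sinh w.\<close>

lemma sinh_shift:
  fixes v w :: complex
  shows "exp w * sinh v - sinh (v - w) = exp v * sinh w"
  by (simp add: sinh_field_def exp_diff exp_minus field_simps)

text \<open>For this conjugate pair the \<open>bar_ix\<close> difference vanishes and the delta is
  1. By \<open>sinh_shift\<close> the bracket then cancels the prefactor
  \<open>exp (- s * u/2)\<close>, leaving
  \<open>2 * sinh (2 * \<eta>) * sinh (kap n * \<eta>)\<close> for both orders.\<close>

lemma a_fun_swap: "a_fun n \<eta> n (Suc n) u = a_fun n \<eta> (Suc n) n u"
proof -
  let ?v = "u / 2" and ?w = "kap n * \<eta>"
  have *: "exp ?w * sinh ?v - sinh (?v - ?w) = exp ?v * sinh ?w"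
    by (rule sinh_shift)
  \<comment> \<open>For the opposite sign both arguments are negated, and oddness of sinh flips all
    three terms.\<close>
  have "exp (- ?w) * sinh ?v - sinh (?v - ?w) = exp (- ?v) * sinh ?w"
    using sinh_shift[of "- ?w" "- ?v"] sinh_minus[of "?v - ?w"] by (simp add: algebra_simps)
  with * have "exp (- ?v) * (exp ?w * sinh ?v - sinh (?v - ?w))
      = exp ?v * (exp (- ?w) * sinh ?v - sinh (?v - ?w))"
    by (simp add: exp_minus)
  then show ?thesis
    by (simp add: a_fun_def bar_ix_def conj_ix_def mult.assoc)
qed

lemma a_fun_transpose:
  assumes "1 \<le> i" "i \<le> 2 * n" "1 \<le> j" "j \<le> 2 * n"
  shows "a_fun n \<eta> (transpose n (Suc n) i) (transpose n (Suc n) j) u = a_fun n \<eta> i j u"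
proof (cases "{i, j} = {n, Suc n}")
  case True
  then show ?thesis by (auto simp: doubleton_eq_iff a_fun_swap)
next
  case False
  \<comment> \<open>Only the pair n, n + 1 can change order, so here the order survives even when i
    and j are conjugate.\<close>
  then have lt: "transpose n (Suc n) i < transpose n (Suc n) j \<longleftrightarrow> i < j"
    by (auto simp: transpose_def)
  show ?thesis
    using assms by (simp add: a_fun_def lt bar_ix_transpose conj_ix_transpose inj_eq)
qed

lemma R_entry_transpose:
  assumes "1 \<le> i" "i \<le> 2 * n" "1 \<le> j" "j \<le> 2 * n" "1 \<le> k" "k \<le> 2 * n"
  shows "R_entry n \<eta> u (transpose n (Suc n) i) (transpose n (Suc n) k)
      (transpose n (Suc n) j) (transpose n (Suc n) l) = R_entry n \<eta> u i k j l"
proof -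
  let ?\<sigma> = "transpose n (Suc n)"
  \<comment> \<open>The comparison is invariant only together with the guard, which removes the pair
    n, n + 1.\<close>
  have "?\<sigma> i < ?\<sigma> j \<and> i \<noteq> conj_ix n j \<longleftrightarrow> i < j \<and> i \<noteq> conj_ix n j"
    using transpose_less_iff by blast
  \<comment> \<open>Within the label range, being conjugate is symmetric in i and j.\<close>
  moreover have "?\<sigma> j < ?\<sigma> i \<and> i \<noteq> conj_ix n j \<longleftrightarrow> j < i \<and> i \<noteq> conj_ix n j"
    using transpose_less_iff[of j n i] assms by (auto simp: conj_ix_def)
  ultimately show ?thesis
    using assms by (simp add: R_entry_def conj_ix_transpose a_fun_transpose inj_eq)
qed

text \<open>Equality of meromorphic functions is rendered pointwise, away from the possible poles of
  the middle entries; for \<open>KL\<close> these are taken at the reflected argument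
  \<open>- u - rho n \<eta>\<close>.\<close>

theorem lemma13:
  fixes n :: nat and \<eta> \<gamma>\<^sub>0 :: complex
  assumes "n \<ge> 1" and "\<gamma>\<^sub>0 \<in> {1, -1}"
  shows "(\<forall>u. leg1 n (Zl n) * R_mat n \<eta> u * leg1 n (Zl n)
             = leg2 n (Zl n) * R_mat n \<eta> u * leg2 n (Zl n)) \<and>
    (\<forall>p<n.
       (\<forall>u. gam n \<eta> \<gamma>\<^sub>0 p + exp u \<noteq> 0 \<longrightarrow>
          Zl n * KR n \<eta> \<gamma>\<^sub>0 p u * Zl n = KR n \<eta> \<gamma>\<^sub>0 p u) \<and>
       (\<forall>u. gam n \<eta> \<gamma>\<^sub>0 p + exp (- u - rho n \<eta>) \<noteq> 0 \<longrightarrow>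
          Zl n * KL n \<eta> \<gamma>\<^sub>0 p u * Zl n = KL n \<eta> \<gamma>\<^sub>0 p u))"
proof -
  define \<pi> where "\<pi> = transpose (n - 1) n"
  have \<pi>_less: "\<pi> i < 2 * n" if "i < 2 * n" for i
    using that assms(1) by (auto simp: \<pi>_def transpose_def)
  have \<pi>_inv: "\<pi> (\<pi> i) = i" for i by (simp add: \<pi>_def)
  \<comment> \<open>Positions count from 0 and labels from 1: swapping positions n - 1 and n swaps
    labels n and n + 1.\<close>
  have Suc_\<pi>: "Suc (\<pi> i) = transpose n (Suc n) (Suc i)" for i
    using assms(1) by (auto simp: \<pi>_def transpose_def)
  note Z = Zl_eq_perm_mat[OF assms(1), folded \<pi>_def]
  have "leg1 n (Zl n) * R_mat n \<eta> u * leg1 n (Zl n)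
      = leg2 n (Zl n) * R_mat n \<eta> u * leg2 n (Zl n)" for u
    unfolding leg1_def leg2_def Z
  proof (rule kron_perm_mat_conj_eq[OF R_mat_carrier \<pi>_less \<pi>_inv])
    fix i k j l assume "i < 2 * n" "k < 2 * n" "j < 2 * n" "l < 2 * n"
    then show "R_mat n \<eta> u $$ (\<pi> i * (2 * n) + \<pi> k, \<pi> j * (2 * n) + \<pi> l)
        = R_mat n \<eta> u $$ (i * (2 * n) + k, j * (2 * n) + l)"
      by (simp add: R_mat_index \<pi>_less Suc_\<pi> R_entry_transpose)
  qed
  \<comment> \<open>As p < n, positions n - 1 and n both lie in the middle block
    \<open>p \<le> i < 2 * n - p\<close>.\<close>
  moreover have "Zl n * KR n \<eta> \<gamma>\<^sub>0 p u * Zl n = KR n \<eta> \<gamma>\<^sub>0 p u" if "p < n" for p u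
    unfolding Z KR_def
    by (rule perm_mat_conj_mat_diag[OF \<pi>_less \<pi>_inv]) (use that in \<open>auto simp: \<pi>_def transpose_def\<close>)
  \<comment> \<open>Both factors of \<open>KL\<close> are diagonal; the entries from
    \<open>M_mat\<close> are invariant because they depend on the label only through
    \<open>bar_ix\<close>.\<close>
  moreover have "Zl n * KL n \<eta> \<gamma>\<^sub>0 p u * Zl n = KL n \<eta> \<gamma>\<^sub>0 p u" if "p < n" for p u
    unfolding Z KL_def KR_def M_mat_def mat_diag_diag
    by (rule perm_mat_conj_mat_diag[OF \<pi>_less \<pi>_inv], unfold Suc_\<pi> bar_ix_transpose)
      (use that in \<open>auto simp: \<pi>_def transpose_def\<close>)
  ultimately show ?thesis by blast
qed

end
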